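(* Let $h>0$ and $\sigma>0$, let $r=h^2/\sigma^2$, and let $K_{h^2}(x,y)=\frac{1}{\sqrt{2\pi}\,h}\exp\left(-\frac{(x-y)^2}{2h^2}\right)$, $x,y\in\mathbb{R}$. Set $w^*=w^*(r)=1-\frac12\left[\sqrt{4r+r^2}-r\right]\in(0,1)$, $a=a(w^* )=\sqrt{\frac{1-(w^* )^2}{2h^2w^*}}$, $b=b(w^* )=\sqrt{\frac{1-w^*}{h^2}}$, and for $n=0,1,2,\ldots$ $$\gamma_n^*(x)=\sqrt{\frac{a\sigma}{2^{n-1/2}\,n!}}\;H_n(ax)\,e^{-b^2x^2/2}.$$ Then, under the baseline measure $N(0,\sigma^2)$, the kernel $K_{h^2}$ has the spectral decomposition $$K_{h^2}(x,y)=\sum_{n=0}^\infty \alpha\beta^n\,\gamma_n^*(x)\gamma_n^*(y),\qquad \beta=w^*(r),\quad \alpha=\frac{(1-(w^* )^2)^{1/2}}{2\sqrt{\pi}\,h\,a(w^* )\,\sigma}.$$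
   Context: $H_n$ denotes the Hermite polynomial $H_n(x)=(-1)^n e^{x^2}\frac{d^n}{dx^n}e^{-x^2}$. For a probability measure $M$ and a symmetric kernel $K$ with $\iint K(x,y)^2\,dM(x)\,dM(y)<\infty$, a spectral decomposition of $K$ under the baseline measure $M$ is a representation $K(x,y)=\sum_j\lambda_j\phi_j(x)\phi_j(y)$ in which the $\phi_j$ are orthonormal in $L_2(M)$ and are eigenfunctions, with eigenvalues $\lambda_j$, of the operator $(Kg)(x)=\int K(x,y)g(y)\,dM(y)$ on $L_2(M)$. *)

theory Defs
  imports "HOL-Probability.Probability"
begin

definition square_integrable :: "'a measure \<Rightarrow> ('a \<Rightarrow> real) \<Rightarrow> bool" where
  "square_integrable M f \<longleftrightarrow> f \<in> borel_measurable M \<and> integrable M (\<lambda>x. (f x)\<^sup>2)"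

definition orthonormal_L2 :: "'a measure \<Rightarrow> (nat \<Rightarrow> 'a \<Rightarrow> real) \<Rightarrow> bool" where
  "orthonormal_L2 M \<phi> \<longleftrightarrow>
     (\<forall>i. square_integrable M (\<phi> i)) \<and>
     (\<forall>i j. (\<integral>x. \<phi> i x * \<phi> j x \<partial>M) = (if i = j then 1 else 0))"

definition L2_kernel :: "'a measure \<Rightarrow> ('a \<Rightarrow> 'a \<Rightarrow> real) \<Rightarrow> bool" where
  "L2_kernel M K \<longleftrightarrow>
     (\<forall>x\<in>space M. \<forall>y\<in>space M. K x y = K y x) \<and>
     square_integrable (M \<Otimes>\<^sub>M M) (\<lambda>(x, y). K x y)"

definition kernel_op :: "'a measure \<Rightarrow> ('a \<Rightarrow> 'a \<Rightarrow> real) \<Rightarrow> ('a \<Rightarrow> real) \<Rightarrow> 'a \<Rightarrow> real" where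
  "kernel_op M K g x = (\<integral>y. K x y * g y \<partial>M)"

(* Elements of L_2(M) are represented by functions, so equations and nonvanishing in L_2(M)
   are read up to M-null sets. *)
definition kernel_eigenfunction ::
  "'a measure \<Rightarrow> ('a \<Rightarrow> 'a \<Rightarrow> real) \<Rightarrow> real \<Rightarrow> ('a \<Rightarrow> real) \<Rightarrow> bool" where
  "kernel_eigenfunction M K \<mu> \<phi> \<longleftrightarrow>
     square_integrable M \<phi> \<and> \<not> (AE x in M. \<phi> x = 0) \<and>
     (AE x in M. kernel_op M K \<phi> x = \<mu> * \<phi> x)"

(* The series converges to K at every point.  Together with the remaining clauses this also
   gives convergence in L_2 of the product measure, by Bessel's inequality and Fatou's lemma. *)
definition spectral_decomposition ::
  "'a measure \<Rightarrow> ('a \<Rightarrow> 'a \<Rightarrow> real) \<Rightarrow> (nat \<Rightarrow> real) \<Rightarrow> (nat \<Rightarrow> 'a \<Rightarrow> real) \<Rightarrow> bool" where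
  "spectral_decomposition M K \<mu> \<phi> \<longleftrightarrow>
     prob_space M \<and> L2_kernel M K \<and>
     orthonormal_L2 M \<phi> \<and>
     (\<forall>j. kernel_eigenfunction M K (\<mu> j) (\<phi> j)) \<and>
     (\<forall>x\<in>space M. \<forall>y\<in>space M. (\<lambda>j. \<mu> j * \<phi> j x * \<phi> j y) sums K x y)"

definition hermite :: "nat \<Rightarrow> real \<Rightarrow> real" where
  "hermite n x = (-1) ^ n * exp (x\<^sup>2) * (deriv ^^ n) (\<lambda>t. exp (- t\<^sup>2)) x"

(* The argument h is the bandwidth: this is K_{h^2}. *)
definition gauss_kernel :: "real \<Rightarrow> real \<Rightarrow> real \<Rightarrow> real" where
  "gauss_kernel h x y = 1 / (sqrt (2 * pi) * h) * exp (- ((x - y)\<^sup>2 / (2 * h\<^sup>2)))"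

(* N(0, sigma^2); normal_density takes the standard deviation. *)
definition normal_measure :: "real \<Rightarrow> real measure" where
  "normal_measure \<sigma> = density lborel (normal_density 0 \<sigma>)"

definition w_star :: "real \<Rightarrow> real" where
  "w_star r = 1 - 1 / 2 * (sqrt (4 * r + r\<^sup>2) - r)"

definition a_coef :: "real \<Rightarrow> real \<Rightarrow> real" where
  "a_coef h w = sqrt ((1 - w\<^sup>2) / (2 * h\<^sup>2 * w))"

definition b_coef :: "real \<Rightarrow> real \<Rightarrow> real" where
  "b_coef h w = sqrt ((1 - w) / h\<^sup>2)"

definition gamma_star :: "real \<Rightarrow> real \<Rightarrow> nat \<Rightarrow> real \<Rightarrow> real" where
  "gamma_star h \<sigma> n x =
     (let w = w_star (h\<^sup>2 / \<sigma>\<^sup>2); a = a_coef h w; b = b_coef h w in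
      sqrt (a * \<sigma> / (2 powr (real n - 1 / 2) * fact n))
        * hermite n (a * x) * exp (- (b\<^sup>2 * x\<^sup>2 / 2)))"

definition alpha_coef :: "real \<Rightarrow> real \<Rightarrow> real" where
  "alpha_coef h \<sigma> =
     (let w = w_star (h\<^sup>2 / \<sigma>\<^sup>2) in
      sqrt (1 - w\<^sup>2) / (2 * sqrt pi * h * a_coef h w * \<sigma>))"

end

theory Submission
  imports Defs "HOL-Real_Asymp.Real_Asymp"
begin

text \<open>
  Mehler's formula
  \<open>(\<Sum>n. w ^ n * H\<^sub>n u * H\<^sub>n v / (2 ^ n * n!)) = exp ((2 u v w - w\<^sup>2 (u\<^sup>2 + v\<^sup>2)) / (1 - w\<^sup>2)) / sqrt (1 - w\<^sup>2)\<close>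
  has a Gaussian of \<open>u\<close> and \<open>v\<close> on the right.  Put \<open>u = a x\<close>, \<open>v = a y\<close> and multiply by Gaussian
  factors in \<open>x\<close> and in \<open>y\<close>: for every \<open>w\<close> in \<open>(0, 1)\<close> there is one choice of \<open>a\<close> and of the factors
  that makes the right side proportional to the kernel (\<open>gauss_kernel_expansion\<close>).  So the kernel has
  a one-parameter family of expansions.  The summands are orthogonal under \<open>N(0, \<sigma>\<^sup>2)\<close> when the damping
  factors and the density together give the Hermite weight \<open>exp (- a\<^sup>2 x\<^sup>2)\<close>
  (\<open>orthonormal_scaled_hermite\<close>), and this amounts to the quadratic equation \<open>(1 - w)\<^sup>2 = r w\<close>, of which
  \<open>w_star r\<close> is the root in \<open>(0, 1)\<close> (\<open>w_star_properties\<close>).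

  That the functions are eigenfunctions then needs no further integral: integrating the expansion
  against one of them term by term leaves a single summand, by orthonormality
  (\<open>spectral_decompositionI\<close>).

  Mehler's formula is proved through a differential equation in \<open>w\<close>.  The three-term
  recurrence of the Hermite polynomials translates into a first-order linear equation for the formal
  power series on the left (\<open>mehler_fps_ode\<close>).  The recurrence also shows that
  \<open>H\<^sub>n x / sqrt (2 ^ n * n!)\<close> grows more slowly than any \<open>q ^ n\<close> with \<open>q > 1\<close>
  (\<open>hermite_normalized_growth\<close>), so the series converges for \<open>\<bar>w\<bar> < 1\<close>, and the right side is the
  solution with value \<open>1\<close> at \<open>w = 0\<close>.  The same growth bound gives the absolute convergence that
  justifies the integration term by term.
\<close>

section \<open>Hermite polynomials\<close>

text \<open>
  The recursion is what differentiating \<open>H x * exp (- x\<^sup>2)\<close> and changing the sign does to the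
  factor \<open>H\<close>.  Keeping the Hermite functions as formal polynomials makes \<open>pderiv\<close> and the
  product rule available as algebraic identities.
\<close>
fun hermite_poly :: "nat \<Rightarrow> real poly" where
  "hermite_poly 0 = 1"
| "hermite_poly (Suc n) = [:0, 2:] * hermite_poly n - pderiv (hermite_poly n)"

lemma funpow_deriv_gauss:
  "(deriv ^^ n) (\<lambda>t. exp (- t\<^sup>2)) = (\<lambda>x::real. (- 1) ^ n * poly (hermite_poly n) x * exp (- x\<^sup>2))"
proof (induction n)
  case (Suc n)
  have "deriv (\<lambda>x::real. (- 1) ^ n * poly (hermite_poly n) x * exp (- x\<^sup>2)) x
      = (- 1) ^ Suc n * poly (hermite_poly (Suc n)) x * exp (- x\<^sup>2)" for x
    by (rule DERIV_imp_deriv)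
      (auto intro!: derivative_eq_intros poly_DERIV simp: algebra_simps)
  then show ?case using Suc by auto
qed auto

lemma hermite_eq_poly: "hermite n x = poly (hermite_poly n) x"
  unfolding hermite_def funpow_deriv_gauss
  by (simp add: algebra_simps flip: exp_add power_mult_distrib)

text \<open>
  Lowering the index by differentiation.  It follows from the defining recursion by induction:
  differentiating \<open>2 x H - H'\<close> produces \<open>2 H\<close> plus the same recursion applied to \<open>H'\<close>, which is
  a multiple of the previous polynomial.  Both the three-term recurrence and the orthogonality
  relations rest on it.
\<close>
lemma pderiv_hermite_poly_Suc:
  "pderiv (hermite_poly (Suc n)) = smult (2 * (real n + 1)) (hermite_poly n)"
proof (induction n)
  case 0
  show ?case by (simp add: pderiv_pCons pderiv_mult one_pCons)
next
  case (Suc n)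
  have "pderiv (hermite_poly (Suc (Suc n)))
      = pderiv [:0, 2:] * hermite_poly (Suc n) + [:0, 2:] * pderiv (hermite_poly (Suc n))
        - pderiv (pderiv (hermite_poly (Suc n)))"
    by (simp only: hermite_poly.simps(2)[of "Suc n"] pderiv_diff pderiv_mult ac_simps)
  also have "\<dots> = smult 2 (hermite_poly (Suc n))
      + smult (2 * (real n + 1)) ([:0, 2:] * hermite_poly n - pderiv (hermite_poly n))"
    unfolding Suc.IH pderiv_smult by (simp add: pderiv_pCons smult_diff_right del: hermite_poly.simps)
  also have "\<dots> = smult 2 (hermite_poly (Suc n)) + smult (2 * (real n + 1)) (hermite_poly (Suc n))"
    by (simp only: hermite_poly.simps(2)[of n])
  also have "\<dots> = smult (2 * (real (Suc n) + 1)) (hermite_poly (Suc n))"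
    by (simp add: algebra_simps del: hermite_poly.simps flip: smult_add_left)
  finally show ?case .
qed

lemma hermite_0: "hermite 0 x = 1"
  by (simp add: hermite_eq_poly)

lemma hermite_1: "hermite (Suc 0) x = 2 * x"
  by (simp add: hermite_eq_poly)

lemma hermite_rec:
  "hermite (Suc (Suc n)) x = 2 * x * hermite (Suc n) x - 2 * (real n + 1) * hermite n x"
proof -
  have "hermite_poly (Suc (Suc n)) = [:0,2:] * hermite_poly (Suc n) - smult (2 * (real n + 1)) (hermite_poly n)"
    using pderiv_hermite_poly_Suc[of n] by (metis hermite_poly.simps(2))
  then show ?thesis by (simp add: hermite_eq_poly del: hermite_poly.simps)
qed

section \<open>Orthogonality under the Gaussian weight\<close>

lemma exp_eq_normal_density: "exp (- x\<^sup>2) = sqrt pi * normal_density 0 (1 / sqrt 2) x"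
  by (simp add: normal_density_def power_divide field_simps)

lemma integrable_poly_gauss:
  fixes p :: "real poly"
  shows "integrable lborel (\<lambda>x. poly p x * exp (- x\<^sup>2))"
proof -
  have "integrable lborel (\<lambda>x::real. x ^ k * exp (- x\<^sup>2))" for k
  proof -
    have "integrable lborel (\<lambda>x. sqrt pi * (normal_density 0 (1 / sqrt 2) x * (x - 0) ^ k))"
      by (intro integrable_mult_right integrable_normal_moment) simp
    moreover have "sqrt pi * (normal_density 0 (1 / sqrt 2) x * (x - 0) ^ k) = x ^ k * exp (- x\<^sup>2)" for x
      unfolding exp_eq_normal_density by simp
    ultimately show ?thesis by (simp only: diff_0_right)
  qed
  then have "integrable lborel (\<lambda>x. \<Sum>i\<le>degree p. coeff p i * (x ^ i * exp (- x\<^sup>2)))"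
    by (intro Bochner_Integration.integrable_sum integrable_mult_right)
  then show ?thesis
    by (simp add: poly_altdef sum_distrib_right mult.assoc)
qed

lemma poly_gauss_tendsto_0:
  "((\<lambda>x::real. poly p x * exp (- x\<^sup>2)) \<longlongrightarrow> 0) at_top"
  "((\<lambda>x::real. poly p x * exp (- x\<^sup>2)) \<longlongrightarrow> 0) at_bot"
proof -
  have "((\<lambda>x::real. x ^ k * exp (- x\<^sup>2)) \<longlongrightarrow> 0) at_top" for k :: nat
    by real_asymp
  moreover have "((\<lambda>x::real. x ^ k * exp (- x\<^sup>2)) \<longlongrightarrow> 0) at_bot" for k :: nat
    by real_asymp
  ultimately have
    "((\<lambda>x. \<Sum>i\<le>degree p. coeff p i * (x ^ i * exp (- x\<^sup>2))) \<longlongrightarrow> (\<Sum>i\<le>degree p. coeff p i * 0)) at_top"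
    "((\<lambda>x. \<Sum>i\<le>degree p. coeff p i * (x ^ i * exp (- x\<^sup>2))) \<longlongrightarrow> (\<Sum>i\<le>degree p. coeff p i * 0)) at_bot"
    by (intro tendsto_sum tendsto_mult_left; simp)+
  then show
    "((\<lambda>x::real. poly p x * exp (- x\<^sup>2)) \<longlongrightarrow> 0) at_top"
    "((\<lambda>x::real. poly p x * exp (- x\<^sup>2)) \<longlongrightarrow> 0) at_bot"
    by (simp_all add: poly_altdef sum_distrib_right mult.assoc)
qed

text \<open>
  The integrand is the derivative of \<open>p * exp (- x\<^sup>2)\<close>, which vanishes at both ends of the line.
\<close>
lemma integral_gauss_divergence:
  fixes p :: "real poly"
  shows "(\<integral>x. poly (pderiv p - [:0, 2:] * p) x * exp (- x\<^sup>2) \<partial>lborel) = 0"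
proof -
  have deriv: "((\<lambda>x. poly p x * exp (- x\<^sup>2)) has_real_derivative
      poly (pderiv p - [:0, 2:] * p) x * exp (- x\<^sup>2)) (at x)" for x :: real
    by (auto intro!: derivative_eq_intros poly_DERIV simp: algebra_simps)
  have "(LBINT x=-\<infinity>..\<infinity>. poly (pderiv p - [:0, 2:] * p) x * exp (- x\<^sup>2)) = 0 - 0"
  proof (rule interval_integral_FTC_integrable)
    show "set_integrable lborel (einterval (- \<infinity>) \<infinity>)
        (\<lambda>x. poly (pderiv p - [:0, 2:] * p) x * exp (- x\<^sup>2))"
      using integrable_poly_gauss[of "pderiv p - [:0, 2:] * p"] by (simp add: set_integrable_def)
    show "isCont (\<lambda>x. poly (pderiv p - [:0, 2:] * p) x * exp (- x\<^sup>2)) x" for x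
      by (intro continuous_intros)
    show "(((\<lambda>x. poly p x * exp (- x\<^sup>2)) \<circ> real_of_ereal) \<longlongrightarrow> 0) (at_right (- \<infinity>))"
      unfolding ereal_tendsto_simps by (rule poly_gauss_tendsto_0)
    show "(((\<lambda>x. poly p x * exp (- x\<^sup>2)) \<circ> real_of_ereal) \<longlongrightarrow> 0) (at_left \<infinity>)"
      unfolding ereal_tendsto_simps by (rule poly_gauss_tendsto_0)
  qed (use deriv in \<open>simp_all add: has_real_derivative_iff_has_vector_derivative\<close>)
  then show ?thesis
    by (simp add: interval_lebesgue_integral_def set_lebesgue_integral_def)
qed

text \<open>
  Under the Gaussian weight, raising a Hermite index is adjoint to differentiation.  Moving the
  derivative onto \<open>q\<close> and then applying \<open>pderiv_hermite_poly_Suc\<close> to a Hermite \<open>q\<close> lowers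
  both indices of an inner product at once, until it is the total mass or contains a derivative of \<open>1\<close>.
\<close>
lemma integral_hermite_by_parts:
  "(\<integral>x. poly (q * hermite_poly (Suc n)) x * exp (- x\<^sup>2) \<partial>lborel)
   = (\<integral>x. poly (pderiv q * hermite_poly n) x * exp (- x\<^sup>2) \<partial>lborel)"
proof -
  have "pderiv (q * hermite_poly n) - [:0, 2:] * (q * hermite_poly n)
      = pderiv q * hermite_poly n - q * hermite_poly (Suc n)"
    by (simp only: pderiv_mult hermite_poly.simps) (simp add: algebra_simps)
  then have "(\<integral>x. poly (pderiv q * hermite_poly n) x * exp (- x\<^sup>2)
        - poly (q * hermite_poly (Suc n)) x * exp (- x\<^sup>2) \<partial>lborel) = 0"
    using integral_gauss_divergence[of "q * hermite_poly n"] by (simp only: poly_diff left_diff_distrib)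
  then show ?thesis
    by (subst (asm) Bochner_Integration.integral_diff) (simp_all only: integrable_poly_gauss)
qed

lemma integral_hermite_mult_hermite:
  "(\<integral>x. poly (hermite_poly m * hermite_poly n) x * exp (- x\<^sup>2) \<partial>lborel)
   = (if m = n then sqrt pi * 2 ^ n * fact n else 0)"
proof (induction n arbitrary: m)
  case 0
  show ?case
  proof (cases m)
    case 0
    have "(\<integral>x. exp (- (x::real)\<^sup>2) \<partial>lborel) = sqrt pi"
      unfolding exp_eq_normal_density by simp
    then show ?thesis using 0 by simp
  next
    case (Suc k)
    then show ?thesis using integral_hermite_by_parts[of 1 k]
      by (simp add: mult.commute del: hermite_poly.simps(2))
  qed
next
  case (Suc n)
  show ?case
  proof (cases m)
    case 0
    then show ?thesis using integral_hermite_by_parts[of 1 n] by (simp del: hermite_poly.simps(2))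
  next
    case (Suc k)
    have "(\<integral>x. poly (hermite_poly m * hermite_poly (Suc n)) x * exp (- x\<^sup>2) \<partial>lborel)
        = (\<integral>x. 2 * (real k + 1) * (poly (hermite_poly k * hermite_poly n) x * exp (- x\<^sup>2)) \<partial>lborel)"
      unfolding integral_hermite_by_parts Suc pderiv_hermite_poly_Suc by (simp add: mult.assoc)
    also have "\<dots> = 2 * (real k + 1) * (if k = n then sqrt pi * 2 ^ n * fact n else 0)"
      by (subst integral_mult_right_zero) (simp only: Suc.IH)
    finally show ?thesis using Suc by (simp add: algebra_simps)
  qed
qed

section \<open>Subexponential growth of the normalised Hermite polynomials\<close>

text \<open>
  Up to the factor \<open>pi powr (1/4)\<close> these are orthonormal for the weight \<open>exp (- x\<^sup>2)\<close>.
\<close>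
definition hermite_normalized :: "nat \<Rightarrow> real \<Rightarrow> real" where
  "hermite_normalized n x = hermite n x / sqrt (2 ^ n * fact n)"

text \<open>
  After normalisation the coefficient of the older term in the three-term recurrence is
  \<open>sqrt ((n + 1) / (n + 2)) \<le> 1\<close>, while that of the newer term tends to \<open>0\<close> for fixed \<open>x\<close>.
\<close>
lemma hermite_normalized_rec_bound:
  "\<bar>hermite_normalized (Suc (Suc n)) x\<bar>
    \<le> \<bar>x\<bar> * sqrt (2 / (real n + 2)) * \<bar>hermite_normalized (Suc n) x\<bar> + \<bar>hermite_normalized n x\<bar>"
proof -
  define D :: real where "D = 2 ^ n * fact n"
  have D: "D > 0" by (simp add: D_def)
  have D1: "2 ^ Suc n * fact (Suc n) = 2 * (real n + 1) * D"
    and D2: "2 ^ Suc (Suc n) * fact (Suc (Suc n)) = 4 * (real n + 1) * (real n + 2) * D"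
    by (simp_all add: D_def algebra_simps)
  have newer: "2 * x * u / sqrt (4 * k * l * D) = x * sqrt (2 / l) * (u / sqrt (2 * k * D))"
    and older: "2 * k * u / sqrt (4 * k * l * D) = sqrt (k / l) * (u / sqrt D)"
    if "k > 0" "l > 0" for k l u :: real
    using that D by (simp_all add: real_sqrt_mult real_sqrt_divide field_simps)
  have "hermite_normalized (Suc (Suc n)) x
      = x * sqrt (2 / (real n + 2)) * hermite_normalized (Suc n) x
        - sqrt ((real n + 1) / (real n + 2)) * hermite_normalized n x"
    unfolding hermite_normalized_def D1 D2 hermite_rec diff_divide_distrib D_def[symmetric]
    by (subst newer, simp, simp, subst older, simp_all)
  also have "\<bar>\<dots>\<bar> \<le> \<bar>x * sqrt (2 / (real n + 2)) * hermite_normalized (Suc n) x\<bar>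
      + \<bar>sqrt ((real n + 1) / (real n + 2)) * hermite_normalized n x\<bar>"
    by (rule abs_triangle_ineq4)
  also have "\<bar>sqrt ((real n + 1) / (real n + 2)) * hermite_normalized n x\<bar> \<le> 1 * \<bar>hermite_normalized n x\<bar>"
    unfolding abs_mult by (intro mult_right_mono) auto
  finally show ?thesis by (simp add: abs_mult)
qed

text \<open>
  Once the coefficient of the newer term has dropped below \<open>q - 1\<close>, the recurrence is dominated by
  \<open>u (n + 2) = (q - 1) * u (n + 1) + u n\<close>, and \<open>q ^ n\<close> is a supersolution of it because
  \<open>(q - 1) * q + 1 \<le> q\<^sup>2\<close> for \<open>q \<ge> 1\<close>.  The finitely many earlier terms only affect the constant.
\<close>
lemma hermite_normalized_growth:
  assumes "q > 1"
  shows "\<exists>C\<ge>0. \<forall>n. \<bar>hermite_normalized n x\<bar> \<le> C * q ^ n"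
proof -
  have "(\<lambda>n. \<bar>x\<bar> * sqrt (2 / (real n + 2))) \<longlonglongrightarrow> \<bar>x\<bar> * sqrt 0"
    by (intro tendsto_mult_left tendsto_real_sqrt) real_asymp
  then have "eventually (\<lambda>n. \<bar>x\<bar> * sqrt (2 / (real n + 2)) < q - 1) sequentially"
    using assms by (intro order_tendstoD) auto
  then obtain N where N: "\<And>n. n \<ge> N \<Longrightarrow> \<bar>x\<bar> * sqrt (2 / (real n + 2)) \<le> q - 1"
    unfolding eventually_sequentially by (meson less_imp_le)
  define C where "C = (\<Sum>k\<le>Suc N. \<bar>hermite_normalized k x\<bar>)"
  have "C \<ge> 0" by (simp add: C_def sum_nonneg)
  moreover have "\<bar>hermite_normalized n x\<bar> \<le> C * q ^ n" for n
  proof (induction n rule: less_induct)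
    case (less n)
    show ?case
    proof (cases "n \<le> Suc N")
      case True
      then have "\<bar>hermite_normalized n x\<bar> \<le> C"
        unfolding C_def by (intro member_le_sum) auto
      also have "\<dots> \<le> C * q ^ n"
        using \<open>C \<ge> 0\<close> assms by (simp add: mult_le_cancel_left1)
      finally show ?thesis .
    next
      case False
      then obtain m where m: "n = Suc (Suc m)" "m \<ge> N"
        by (metis Suc_le_D Suc_le_mono not_less_eq_eq)
      have "\<bar>hermite_normalized n x\<bar> \<le> (q - 1) * (C * q ^ Suc m) + C * q ^ m"
        unfolding m(1) using N[OF m(2)] assms less.IH[of "Suc m"] less.IH[of m] m(1)
        by (intro order_trans[OF hermite_normalized_rec_bound] add_mono mult_mono)
           (simp_all del: power_Suc)
      also have "\<dots> = C * q ^ m * (q\<^sup>2 - (q - 1))"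
        by (simp add: power2_eq_square algebra_simps)
      also have "\<dots> \<le> C * q ^ m * q\<^sup>2"
        using assms \<open>C \<ge> 0\<close> by (intro mult_left_mono) auto
      finally show ?thesis by (simp add: m(1) power2_eq_square algebra_simps)
    qed
  qed
  ultimately show ?thesis by blast
qed

lemma summable_hermite_normalized:
  assumes "\<bar>w\<bar> < 1"
  shows "summable (\<lambda>n. \<bar>w\<bar> ^ n * \<bar>hermite_normalized n x\<bar>)"
    and "summable (\<lambda>n. \<bar>w\<bar> ^ n * \<bar>hermite_normalized n x * hermite_normalized n y\<bar>)"
proof -
  \<comment> \<open>any \<open>q > 1\<close> with \<open>q\<^sup>2 * \<bar>w\<bar> < 1\<close> would do, the square because two factors grow like \<open>q ^ n\<close>\<close>
  define q where "q = sqrt (2 / (1 + \<bar>w\<bar>))"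
  have q: "q > 1" "q\<^sup>2 * \<bar>w\<bar> < 1"
    using assms by (auto simp: q_def field_simps)
  have qw: "q * \<bar>w\<bar> < 1"
    using q by (smt (verit) mult_right_mono power2_eq_square mult_less_cancel_left1 mult_left_mono abs_ge_zero)
  obtain C where C: "C \<ge> 0" "\<And>n. \<bar>hermite_normalized n x\<bar> \<le> C * q ^ n"
    using hermite_normalized_growth[OF q(1)] by blast
  obtain D where D: "D \<ge> 0" "\<And>n. \<bar>hermite_normalized n y\<bar> \<le> D * q ^ n"
    using hermite_normalized_growth[OF q(1)] by blast
  show "summable (\<lambda>n. \<bar>w\<bar> ^ n * \<bar>hermite_normalized n x\<bar>)"
  proof (rule summable_comparison_test')
    show "summable (\<lambda>n. C * (q * \<bar>w\<bar>) ^ n)"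
      using q qw by (intro summable_mult summable_geometric) auto
    show "norm (\<bar>w\<bar> ^ n * \<bar>hermite_normalized n x\<bar>) \<le> C * (q * \<bar>w\<bar>) ^ n" for n
      using mult_left_mono[OF C(2)[of n], of "\<bar>w\<bar> ^ n"] by (simp add: power_mult_distrib mult_ac)
  qed
  show "summable (\<lambda>n. \<bar>w\<bar> ^ n * \<bar>hermite_normalized n x * hermite_normalized n y\<bar>)"
  proof (rule summable_comparison_test')
    show "summable (\<lambda>n. C * D * (q\<^sup>2 * \<bar>w\<bar>) ^ n)"
      using q by (intro summable_mult summable_geometric) auto
    show "norm (\<bar>w\<bar> ^ n * \<bar>hermite_normalized n x * hermite_normalized n y\<bar>) \<le> C * D * (q\<^sup>2 * \<bar>w\<bar>) ^ n" for n
    proof -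
      have "\<bar>hermite_normalized n x\<bar> * \<bar>hermite_normalized n y\<bar> \<le> (C * q ^ n) * (D * q ^ n)"
        using C q by (intro mult_mono C D) auto
      from mult_left_mono[OF this, of "\<bar>w\<bar> ^ n"] show ?thesis
        by (simp add: power_mult_distrib abs_mult power2_eq_square mult_ac)
    qed
  qed
qed

section \<open>Mehler's formula\<close>

definition mehler_fps :: "real \<Rightarrow> real \<Rightarrow> real fps" where
  "mehler_fps x y = Abs_fps (\<lambda>n. hermite_normalized n x * hermite_normalized n y)"

lemma fps_nth_mehler: "fps_nth (mehler_fps x y) n = hermite n x * hermite n y / (2 ^ n * fact n)"
  by (simp add: mehler_fps_def hermite_normalized_def)

lemma mehler_conv_radius: "fps_conv_radius (mehler_fps x y) \<ge> 1"
  unfolding fps_conv_radius_def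
proof (rule conv_radius_geI_ex')
  fix r :: real assume r: "0 < r" "ereal r < 1"
  then have "\<bar>r\<bar> < 1" by simp
  from summable_hermite_normalized(2)[OF this, of x y]
  show "summable (\<lambda>n. fps_nth (mehler_fps x y) n * of_real r ^ n)"
    by (intro summable_norm_cancel[where f = "\<lambda>n. fps_nth (mehler_fps x y) n * of_real r ^ n"])
       (simp add: mehler_fps_def abs_mult power_abs mult_ac)
qed

text \<open>
  With \<open>M\<close> the Mehler series, let \<open>P\<close> and \<open>Q\<close> be the series in which the index of the first or the
  second Hermite factor is raised by one.  The three-term recurrence, read coefficientwise, gives
  \<open>P = 2 x M - X Q\<close> and \<open>Q = 2 y M - X P\<close>, and applied to \<open>M'\<close> it gives
  \<open>M' = x Q - y X Q + X M + X\<^sup>2 M'\<close>.  Eliminating \<open>P\<close> and \<open>Q\<close> leaves a first-order linear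
  equation for \<open>M\<close> alone.  The elimination takes place in the ring of formal power series,
  where it needs no convergence of \<open>P\<close> and \<open>Q\<close>.
\<close>
lemma mehler_fps_ode:
  "fps_of_poly ([:1, 0, -1:] ^ 2) * fps_deriv (mehler_fps x y)
   = fps_of_poly (smult 2 ([:x, -y:] * [:y, -x:]) + [:0, 1:] * [:1, 0, -1:]) * mehler_fps x y"
proof -
  define M where "M = mehler_fps x y"
  define P where "P = Abs_fps (\<lambda>n. hermite (Suc n) x * hermite n y / (2 ^ n * fact n))"
  define Q where "Q = Abs_fps (\<lambda>n. hermite n x * hermite (Suc n) y / (2 ^ n * fact n))"
  have step: "hermite (Suc (Suc k)) u * hermite (Suc k) v / (2 ^ Suc k * fact (Suc k))
      = 2 * u * (hermite (Suc k) u * hermite (Suc k) v / (2 ^ Suc k * fact (Suc k)))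
        - hermite k u * hermite (Suc k) v / (2 ^ k * fact k)" for k u v
  proof -
    define D :: real where "D = 2 ^ k * fact k"
    have D: "D \<noteq> 0" "real k + 1 \<noteq> 0" by (simp_all add: D_def)
    have "2 ^ Suc k * fact (Suc k) = 2 * (real k + 1) * D" by (simp add: D_def algebra_simps)
    then show ?thesis
      unfolding hermite_rec D_def[symmetric] using D
      by (simp only: diff_divide_distrib left_diff_distrib) (simp add: divide_simps)
  qed
  have P: "P = fps_const (2 * x) * M - fps_X * Q"
  proof (rule fps_ext)
    fix n show "fps_nth P n = fps_nth (fps_const (2 * x) * M - fps_X * Q) n"
      unfolding P_def Q_def M_def
      by (cases n) (simp_all add: fps_nth_mehler hermite_0 hermite_1 step del: power_Suc fact_Suc)
  qed
  have Q: "Q = fps_const (2 * y) * M - fps_X * P"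
  proof (rule fps_ext)
    fix n show "fps_nth Q n = fps_nth (fps_const (2 * y) * M - fps_X * P) n"
      unfolding P_def Q_def M_def using step[of _ y x]
      by (cases n) (simp_all add: fps_nth_mehler hermite_0 hermite_1 mult.commute del: power_Suc fact_Suc)
  qed
  have M': "fps_deriv M = fps_const x * Q - fps_const y * (fps_X * Q) + fps_X * M + fps_X * (fps_X * fps_deriv M)"
  proof (rule fps_ext)
    fix n
    show "fps_nth (fps_deriv M) n = fps_nth (fps_const x * Q - fps_const y * (fps_X * Q) + fps_X * M
        + fps_X * (fps_X * fps_deriv M)) n"
    proof (cases n)
      case 0
      then show ?thesis by (simp add: Q_def M_def fps_nth_mehler hermite_0 hermite_1)
    next
      case (Suc k)
      define D :: real where "D = 2 ^ k * fact k"
      have D: "D \<noteq> 0" by (simp add: D_def)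
      have D1: "2 ^ Suc k * fact (Suc k) = 2 * (real k + 1) * D"
        and D2: "2 ^ Suc (Suc k) * fact (Suc (Suc k)) = 4 * (real k + 1) * (real k + 2) * D"
        by (simp_all add: D_def algebra_simps)
      have XM: "fps_nth (fps_X * fps_deriv M) k = real k * fps_nth M k"
        by (cases k) simp_all
      have nz: "real k + 1 \<noteq> 0" "real k + 2 \<noteq> 0" by linarith+
      have "fps_nth (fps_deriv M) n = (real k + 2) * fps_nth M (Suc (Suc k))"
        by (simp add: Suc)
      also have "\<dots> = hermite (Suc (Suc k)) x * hermite (Suc (Suc k)) y / (4 * (real k + 1) * D)"
        unfolding M_def fps_nth_mehler D2 using nz D by (simp add: divide_simps)
      also have "\<dots> = x * (hermite (Suc k) x * hermite (Suc (Suc k)) y / (2 * (real k + 1) * D))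
          - y * (hermite k x * hermite (Suc k) y / D) + (real k + 1) * (hermite k x * hermite k y / D)"
        unfolding hermite_rec using nz D by (simp add: divide_simps) (simp add: algebra_simps)
      also have "\<dots> = x * fps_nth Q (Suc k) - y * fps_nth Q k + fps_nth M k + real k * fps_nth M k"
        unfolding M_def fps_nth_mehler Q_def fps_nth_Abs_fps D1 D_def[symmetric]
        by (simp add: algebra_simps add_divide_distrib)
      finally show ?thesis by (simp add: Suc XM)
    qed
  qed
  have "(1 - fps_X ^ 2) * Q = 2 * (fps_const y - fps_X * fps_const x) * M"
  proof -
    have "(1 - fps_X ^ 2) * Q = Q - fps_X * (fps_X * Q)" by (simp add: power2_eq_square algebra_simps)
    also have "fps_X * Q = fps_const (2 * x) * M - P" using P by simp
    also have "Q - fps_X * \<dots> = (Q + fps_X * P) - fps_X * fps_const (2 * x) * M" by (simp add: algebra_simps)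
    also have "Q + fps_X * P = fps_const (2 * y) * M" using Q by simp
    finally show ?thesis by (simp add: algebra_simps flip: fps_const_mult numeral_fps_const)
  qed
  moreover have "(1 - fps_X ^ 2) * fps_deriv M = (fps_const x - fps_const y * fps_X) * Q + fps_X * M"
    using M' by (simp add: power2_eq_square algebra_simps)
  ultimately have "(1 - fps_X ^ 2) ^ 2 * fps_deriv M
     = (2 * (fps_const x - fps_const y * fps_X) * (fps_const y - fps_X * fps_const x)
        + fps_X * (1 - fps_X ^ 2)) * M"
    by algebra
  moreover have "fps_of_poly [:1, 0, -1:] = (1 - fps_X ^ 2 :: real fps)"
    by (simp add: fps_of_poly_pCons power2_eq_square)
  moreover have "fps_of_poly [:u, -v:] = fps_const u - fps_const v * fps_X" for u v :: real
    by (simp add: fps_of_poly_pCons mult.commute flip: fps_const_neg)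
  ultimately show ?thesis
    unfolding M_def[symmetric]
    by (simp only: fps_of_poly_add fps_of_poly_mult fps_of_poly_smult fps_of_poly_power
        fps_of_poly_fps_X mult_ac flip: numeral_fps_const)
qed

lemma eval_mehler_fps_deriv:
  assumes "\<bar>w\<bar> < 1"
  shows "(eval_fps (mehler_fps x y) has_real_derivative
     (2 * (x - y * w) * (y - x * w) + w * (1 - w\<^sup>2)) / (1 - w\<^sup>2)\<^sup>2 * eval_fps (mehler_fps x y) w) (at w)"
proof -
  have w: "norm w < fps_conv_radius (mehler_fps x y)"
    using assms mehler_conv_radius[of x y] less_le_trans[of "ereal (norm w)" 1] by simp
  then have w': "norm w < fps_conv_radius (fps_deriv (mehler_fps x y))"
    using fps_conv_radius_deriv[of "mehler_fps x y"] less_le_trans by blast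
  have "(1 - w\<^sup>2)\<^sup>2 * eval_fps (fps_deriv (mehler_fps x y)) w
     = (2 * (x - y * w) * (y - x * w) + w * (1 - w\<^sup>2)) * eval_fps (mehler_fps x y) w"
    using arg_cong[OF mehler_fps_ode[of x y], of "\<lambda>f. eval_fps f w"] w w'
    by (subst (asm) (1 2) eval_fps_mult) (simp_all add: algebra_simps power2_eq_square)
  moreover have "1 - w\<^sup>2 \<noteq> 0"
    using assms abs_square_less_1[of w] by simp
  ultimately have "eval_fps (fps_deriv (mehler_fps x y)) w
     = (2 * (x - y * w) * (y - x * w) + w * (1 - w\<^sup>2)) / (1 - w\<^sup>2)\<^sup>2 * eval_fps (mehler_fps x y) w"
    by (simp add: field_simps)
  then show ?thesis
    using has_field_derivative_eval_fps[OF w, of UNIV] by simp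
qed

text \<open>
  The reciprocal \<open>g\<close> of the claimed value satisfies the same linear equation with the opposite sign,
  so its product with the series is constant on \<open>(-1, 1)\<close>; at \<open>0\<close> the product is \<open>1\<close>.
\<close>
theorem mehler_formula:
  assumes "\<bar>w\<bar> < 1"
  shows "(\<lambda>n. w ^ n * (hermite_normalized n x * hermite_normalized n y)) sums
    (exp ((2 * x * y * w - w\<^sup>2 * (x\<^sup>2 + y\<^sup>2)) / (1 - w\<^sup>2)) / sqrt (1 - w\<^sup>2))"
proof -
  let ?f = "eval_fps (mehler_fps x y)"
  let ?L = "\<lambda>w. (2 * (x - y * w) * (y - x * w) + w * (1 - w\<^sup>2)) / (1 - w\<^sup>2)\<^sup>2"
  let ?g = "\<lambda>w. sqrt (1 - w\<^sup>2) * exp (- ((2 * x * y * w - w\<^sup>2 * (x\<^sup>2 + y\<^sup>2)) / (1 - w\<^sup>2)))"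
  have pos: "1 - v\<^sup>2 > 0" if "\<bar>v\<bar> < 1" for v :: real
    using that abs_square_less_1[of v] by simp
  have g: "(?g has_real_derivative - ?L v * ?g v) (at v)" if "\<bar>v\<bar> < 1" for v
  proof -
    define s where "s = 1 - v\<^sup>2"
    have s: "s > 0" "v\<^sup>2 = 1 - s" using pos[OF that] by (simp_all add: s_def)
    have sq: "inverse (sqrt s) = sqrt s / s"
      using s by (simp add: field_simps)
    have "(?g has_real_derivative
       (inverse (sqrt s) / 2 * (- (2 * v))) * exp (- ((2 * x * y * v - v\<^sup>2 * (x\<^sup>2 + y\<^sup>2)) / s))
       + sqrt s * (exp (- ((2 * x * y * v - v\<^sup>2 * (x\<^sup>2 + y\<^sup>2)) / s)) *
          (- (((2 * x * y - 2 * v * (x\<^sup>2 + y\<^sup>2)) * s - (2 * x * y * v - v\<^sup>2 * (x\<^sup>2 + y\<^sup>2)) * (- (2 * v))) / (s * s))))) (at v)"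
      unfolding s_def using pos[OF that]
      by (auto intro!: derivative_eq_intros)
    also have "(inverse (sqrt s) / 2 * (- (2 * v))) * exp (- ((2 * x * y * v - v\<^sup>2 * (x\<^sup>2 + y\<^sup>2)) / s))
       + sqrt s * (exp (- ((2 * x * y * v - v\<^sup>2 * (x\<^sup>2 + y\<^sup>2)) / s)) *
          (- (((2 * x * y - 2 * v * (x\<^sup>2 + y\<^sup>2)) * s - (2 * x * y * v - v\<^sup>2 * (x\<^sup>2 + y\<^sup>2)) * (- (2 * v))) / (s * s))))
       = - ((v * s + (2 * x * y - 2 * v * (x\<^sup>2 + y\<^sup>2)) * s + 2 * v * (2 * x * y * v - v\<^sup>2 * (x\<^sup>2 + y\<^sup>2))) / s\<^sup>2)
         * (sqrt s * exp (- ((2 * x * y * v - v\<^sup>2 * (x\<^sup>2 + y\<^sup>2)) / s)))"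
      unfolding sq using s(1) by (simp add: field_simps power2_eq_square)
    also have "v * s + (2 * x * y - 2 * v * (x\<^sup>2 + y\<^sup>2)) * s + 2 * v * (2 * x * y * v - v\<^sup>2 * (x\<^sup>2 + y\<^sup>2))
       = 2 * (x - y * v) * (y - x * v) + v * (1 - v\<^sup>2)"
      unfolding s_def by algebra
    finally show ?thesis by (simp add: s_def)
  qed
  have "?f w * ?g w = ?f 0 * ?g 0"
  proof (rule DERIV_isconst3[of "-1" 1 w 0 "\<lambda>v. ?f v * ?g v"])
    fix v :: real assume "v \<in> {-1<..<1}"
    then have v: "\<bar>v\<bar> < 1" by auto
    show "((\<lambda>v. ?f v * ?g v) has_real_derivative 0) (at v)"
      by (rule DERIV_cong[OF DERIV_mult[OF eval_mehler_fps_deriv[OF v] g[OF v]]]) algebra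
  qed (use assms in auto)
  also have "\<dots> = 1"
    by (simp add: eval_fps_at_0 fps_nth_mehler hermite_0)
  finally have "?f w = exp ((2 * x * y * w - w\<^sup>2 * (x\<^sup>2 + y\<^sup>2)) / (1 - w\<^sup>2)) / sqrt (1 - w\<^sup>2)"
    using pos[OF assms] by (simp add: exp_minus field_simps)
  moreover have "(\<lambda>n. fps_nth (mehler_fps x y) n * w ^ n) sums ?f w"
    using assms mehler_conv_radius[of x y] less_le_trans[of "ereal (norm w)" 1]
    by (intro sums_eval_fps) simp
  ultimately show ?thesis by (simp add: mehler_fps_def mult_ac)
qed

section \<open>Eigenfunctions from a pointwise expansion\<close>

text \<open>
  A pointwise expansion of the kernel in orthonormal functions already forces them to be
  eigenfunctions: integrate the series for \<open>K x\<close> against \<open>\<phi> n\<close> term by term, and orthonormality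
  leaves only the \<open>n\<close>-th term.  Exchanging sum and integral is legitimate because each product
  \<open>\<phi> j * \<phi> n\<close> has \<open>L\<^sub>1\<close>-norm at most \<open>1\<close>, so the integrals of the absolute values of the summands
  are dominated by the summable \<open>\<bar>\<mu> j * \<phi> j x\<bar>\<close>.
\<close>
lemma spectral_decompositionI:
  assumes "prob_space M" and "L2_kernel M K" and on: "orthonormal_L2 M \<phi>"
    and summable1: "\<And>x. x \<in> space M \<Longrightarrow> summable (\<lambda>j. \<bar>\<mu> j * \<phi> j x\<bar>)"
    and summable2: "\<And>x y. x \<in> space M \<Longrightarrow> y \<in> space M \<Longrightarrow> summable (\<lambda>j. \<bar>\<mu> j * \<phi> j x * \<phi> j y\<bar>)"
    and sums: "\<And>x y. x \<in> space M \<Longrightarrow> y \<in> space M \<Longrightarrow> (\<lambda>j. \<mu> j * \<phi> j x * \<phi> j y) sums K x y"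
  shows "spectral_decomposition M K \<mu> \<phi>"
proof -
  have meas[measurable]: "\<phi> i \<in> borel_measurable M" and sq: "integrable M (\<lambda>x. (\<phi> i x)\<^sup>2)"
    and inner: "(\<integral>x. \<phi> i x * \<phi> j x \<partial>M) = (if i = j then 1 else 0)" for i j
    using on by (auto simp: orthonormal_L2_def square_integrable_def)
  have AM_GM: "\<bar>\<phi> i x * \<phi> j x\<bar> \<le> ((\<phi> i x)\<^sup>2 + (\<phi> j x)\<^sup>2) / 2" for i j x
    using sum_squares_bound[of "\<bar>\<phi> i x\<bar>" "\<bar>\<phi> j x\<bar>"] by (simp add: abs_mult)
  have int_prod: "integrable M (\<lambda>x. \<phi> i x * \<phi> j x)" for i j
    by (rule Bochner_Integration.integrable_bound[where f = "\<lambda>x. ((\<phi> i x)\<^sup>2 + (\<phi> j x)\<^sup>2) / 2"])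
       (use sq AM_GM in auto)
  have norm_prod: "(\<integral>x. \<bar>\<phi> i x * \<phi> j x\<bar> \<partial>M) \<le> 1" for i j
  proof -
    have "(\<integral>x. \<bar>\<phi> i x * \<phi> j x\<bar> \<partial>M) \<le> (\<integral>x. ((\<phi> i x)\<^sup>2 + (\<phi> j x)\<^sup>2) / 2 \<partial>M)"
      using int_prod sq AM_GM by (intro integral_mono) auto
    also have "\<dots> = 1"
      using sq inner[of i i] inner[of j j] by (simp add: power2_eq_square)
    finally show ?thesis .
  qed
  have op: "kernel_op M K (\<phi> n) x = \<mu> n * \<phi> n x" if x: "x \<in> space M" for n x
  proof -
    let ?f = "\<lambda>j y. \<mu> j * \<phi> j x * (\<phi> j y * \<phi> n y)"
    have "kernel_op M K (\<phi> n) x = (\<integral>y. (\<Sum>j. ?f j y) \<partial>M)"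
      unfolding kernel_op_def
    proof (intro Bochner_Integration.integral_cong refl)
      fix y assume "y \<in> space M"
      from sums_mult2[OF sums[OF x this], of "\<phi> n y"]
      show "K x y * \<phi> n y = (\<Sum>j. ?f j y)" by (simp add: sums_iff mult_ac)
    qed
    also have "\<dots> = (\<Sum>j. \<integral>y. ?f j y \<partial>M)"
    proof (rule integral_suminf)
      show "integrable M (?f j)" for j
        using int_prod by simp
      show "AE y in M. summable (\<lambda>j. norm (?f j y))"
      proof (rule AE_I2)
        fix y assume "y \<in> space M"
        from summable_mult2[OF summable2[OF x this], of "\<bar>\<phi> n y\<bar>"]
        show "summable (\<lambda>j. norm (?f j y))" by (simp add: abs_mult mult_ac)
      qed
      show "summable (\<lambda>j. \<integral>y. norm (?f j y) \<partial>M)"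
      proof (rule summable_comparison_test'[OF summable1[OF x]])
        fix j :: nat
        have "(\<integral>y. norm (?f j y) \<partial>M) = \<bar>\<mu> j * \<phi> j x\<bar> * (\<integral>y. \<bar>\<phi> j y * \<phi> n y\<bar> \<partial>M)"
          by (simp add: abs_mult)
        also have "\<dots> \<le> \<bar>\<mu> j * \<phi> j x\<bar> * 1"
          by (intro mult_left_mono norm_prod) simp
        finally show "norm (\<integral>y. norm (?f j y) \<partial>M) \<le> \<bar>\<mu> j * \<phi> j x\<bar>" by simp
      qed
    qed
    also have "\<dots> = (\<Sum>j. if j = n then \<mu> n * \<phi> n x else 0)"
      by (intro suminf_cong) (simp add: inner)
    also have "\<dots> = \<mu> n * \<phi> n x"
      using sums_single[of n "\<lambda>j. \<mu> j * \<phi> j x"] by (simp add: sums_iff cong: if_cong)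
    finally show ?thesis .
  qed
  have nz: "\<not> (AE x in M. \<phi> n x = 0)" for n
  proof
    assume "AE x in M. \<phi> n x = 0"
    then have "(\<integral>x. \<phi> n x * \<phi> n x \<partial>M) = 0"
      by (intro integral_eq_zero_AE) auto
    then show False using inner[of n n] by simp
  qed
  show ?thesis
    unfolding spectral_decomposition_def kernel_eigenfunction_def
    using assms nz op by (auto simp: orthonormal_L2_def)
qed

section \<open>The Gaussian kernel\<close>

text \<open>The kernel is bounded, hence square integrable for any probability measure.\<close>
lemma L2_kernel_gauss:
  assumes "h > 0" "prob_space M" "sets M = sets borel"
  shows "L2_kernel M (gauss_kernel h)"
proof -
  interpret prob_space M by fact
  interpret pair_prob_space M M ..
  have [measurable_cong]: "sets M = sets borel" by fact
  have [measurable]: "(\<lambda>(x, y). gauss_kernel h x y) \<in> borel_measurable (M \<Otimes>\<^sub>M M)"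
    unfolding gauss_kernel_def by measurable
  have bound: "\<bar>gauss_kernel h x y\<bar> \<le> 1 / (sqrt (2 * pi) * h)" for x y
    using assms(1) by (simp add: gauss_kernel_def abs_mult divide_right_mono)
  have "integrable (M \<Otimes>\<^sub>M M) (\<lambda>z. (case z of (x, y) \<Rightarrow> gauss_kernel h x y)\<^sup>2)"
  proof (rule P.integrable_const_bound)
    show "AE z in M \<Otimes>\<^sub>M M. norm ((case z of (x, y) \<Rightarrow> gauss_kernel h x y)\<^sup>2) \<le> (1 / (sqrt (2 * pi) * h))\<^sup>2"
      using bound assms(1) by (intro AE_I2) (auto simp: split_beta power_mono_iff abs_le_square_iff[symmetric])
  qed measurable
  moreover have "gauss_kernel h x y = gauss_kernel h y x" for x y
    by (simp add: gauss_kernel_def power2_commute)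
  ultimately show ?thesis
    by (auto simp: L2_kernel_def square_integrable_def)
qed

text \<open>
  \<open>w\<close> is the root in \<open>(0, 1)\<close> of \<open>(1 - w)\<^sup>2 = r w\<close>.  This quadratic equation is what links the
  parameter of Mehler's formula to the variance of the baseline measure.
\<close>
lemma w_star_properties:
  assumes "r > 0"
  shows "0 < w_star r" "w_star r < 1" "(1 - w_star r)\<^sup>2 = r * w_star r"
proof -
  define s where "s = sqrt (4 * r + r\<^sup>2)"
  have s2: "s\<^sup>2 = 4 * r + r\<^sup>2" using assms by (simp add: s_def)
  have "s < r + 2"
    unfolding s_def using assms by (intro real_less_lsqrt) (auto simp: power2_eq_square algebra_simps)
  moreover have "r < s"
    unfolding s_def using assms by (intro real_less_rsqrt) auto
  ultimately show "0 < w_star r" "w_star r < 1"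
    by (simp_all add: w_star_def s_def)
  show "(1 - w_star r)\<^sup>2 = r * w_star r"
    using s2 unfolding w_star_def s_def[symmetric] by (simp add: power2_eq_square field_simps)
qed

text \<open>
  The Gaussian damping factors contribute \<open>c\<close> and the density contributes \<open>1 / (2 * \<sigma>\<^sup>2)\<close> to the
  exponent.  Their sum being \<open>a\<^sup>2\<close> is exactly what turns the inner product, after rescaling by \<open>a\<close>,
  into one for the weight \<open>exp (- x\<^sup>2)\<close>.
\<close>
lemma orthonormal_scaled_hermite:
  assumes "a > 0" "\<sigma> > 0" and c: "c = a\<^sup>2 - 1 / (2 * \<sigma>\<^sup>2)"
  shows "orthonormal_L2 (normal_measure \<sigma>)
    (\<lambda>n x. sqrt (a * \<sigma> * sqrt 2) * hermite_normalized n (a * x) * exp (- (c * x\<^sup>2 / 2)))"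
    (is "orthonormal_L2 _ ?\<phi>")
proof -
  have [measurable]: "hermite_normalized n \<in> borel_measurable borel" for n
    unfolding hermite_normalized_def[abs_def] hermite_eq_poly
    by (intro borel_measurable_continuous_onI continuous_intros) simp
  have meas[measurable]: "?\<phi> n \<in> borel_measurable borel" for n
    by measurable
  let ?g = "\<lambda>m n x. poly (hermite_poly m * hermite_poly n) x * exp (- x\<^sup>2)"
  define k :: "nat \<Rightarrow> nat \<Rightarrow> real" where
    "k m n = a / sqrt pi / (sqrt (2 ^ m * fact m) * sqrt (2 ^ n * fact n))" for m n
  have dens: "normal_density 0 \<sigma> x * (?\<phi> m x * ?\<phi> n x) = k m n * ?g m n (0 + a * x)" for m n x
  proof -
    have "exp (- x\<^sup>2 / (2 * \<sigma>\<^sup>2)) * (exp (- (c * x\<^sup>2 / 2)) * exp (- (c * x\<^sup>2 / 2))) = exp (- (a * x)\<^sup>2)"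
      unfolding c by (simp add: power_mult_distrib algebra_simps diff_divide_distrib flip: exp_add)
    moreover have "sqrt (a * \<sigma> * sqrt 2) * sqrt (a * \<sigma> * sqrt 2) = a * \<sigma> * sqrt 2"
      using assms by simp
    moreover have "1 / sqrt (2 * pi * \<sigma>\<^sup>2) * (a * \<sigma> * sqrt 2) = a / sqrt pi"
      using assms by (simp add: real_sqrt_mult field_simps)
    moreover have "normal_density 0 \<sigma> x * (?\<phi> m x * ?\<phi> n x)
       = (1 / sqrt (2 * pi * \<sigma>\<^sup>2) * (sqrt (a * \<sigma> * sqrt 2) * sqrt (a * \<sigma> * sqrt 2)))
         * (hermite_normalized m (a * x) * hermite_normalized n (a * x))
         * (exp (- x\<^sup>2 / (2 * \<sigma>\<^sup>2)) * (exp (- (c * x\<^sup>2 / 2)) * exp (- (c * x\<^sup>2 / 2))))"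
      by (simp add: normal_density_def)
    ultimately show ?thesis
      by (simp only:) (simp add: hermite_normalized_def hermite_eq_poly k_def)
  qed
  have int: "integrable lborel (\<lambda>x. ?g m n (0 + a * x))" for m n
    using assms by (intro lborel_integrable_real_affine integrable_poly_gauss) simp
  have inner: "(\<integral>x. ?\<phi> m x * ?\<phi> n x \<partial>normal_measure \<sigma>) = (if m = n then 1 else 0)" for m n
  proof -
    have "(\<integral>x. ?\<phi> m x * ?\<phi> n x \<partial>normal_measure \<sigma>) = (\<integral>x. normal_density 0 \<sigma> x * (?\<phi> m x * ?\<phi> n x) \<partial>lborel)"
      unfolding normal_measure_def by (subst integral_density) auto
    also have "\<dots> = k m n * (\<integral>x. ?g m n (0 + a * x) \<partial>lborel)"
      unfolding dens by (rule integral_mult_right_zero)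
    also have "(\<integral>x. ?g m n (0 + a * x) \<partial>lborel) = (\<integral>x. ?g m n x \<partial>lborel) / a"
      using lborel_integral_real_affine[of a "?g m n" 0] assms by (simp add: field_simps)
    also have "\<dots> = (if m = n then sqrt pi * (2 ^ n * fact n) / a else 0)"
      unfolding integral_hermite_mult_hermite by simp
    also have "k m n * \<dots> = (if m = n then 1 else 0)"
      using assms by (simp add: k_def)
    finally show ?thesis .
  qed
  have "integrable lborel (\<lambda>x. normal_density 0 \<sigma> x * (?\<phi> n x)\<^sup>2)" for n
    unfolding power2_eq_square[of "?\<phi> n _"] dens by (intro integrable_mult_right int)
  then have "integrable (normal_measure \<sigma>) (\<lambda>x. (?\<phi> n x)\<^sup>2)" for n
    unfolding normal_measure_def by (subst integrable_density) auto
  then show ?thesis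
    using inner by (auto simp: orthonormal_L2_def square_integrable_def normal_measure_def)
qed

lemma gamma_star_eq:
  assumes "h > 0" "\<sigma> > 0" and w: "w = w_star (h\<^sup>2 / \<sigma>\<^sup>2)" and a: "a = a_coef h w"
  shows "gamma_star h \<sigma> n x
    = sqrt (a * \<sigma> * sqrt 2) * hermite_normalized n (a * x) * exp (- ((1 - w) / h\<^sup>2 * x\<^sup>2 / 2))"
proof -
  have "h\<^sup>2 / \<sigma>\<^sup>2 > 0" using assms by simp
  from w_star_properties[OF this] have "w < 1" by (simp add: w)
  then have b: "(b_coef h w)\<^sup>2 = (1 - w) / h\<^sup>2" by (simp add: b_coef_def)
  have "2 powr (real n - 1 / 2) = 2 ^ n / sqrt 2"
    by (simp add: powr_diff powr_half_sqrt powr_realpow)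
  then have "sqrt (a * \<sigma> / (2 powr (real n - 1 / 2) * fact n)) = sqrt (a * \<sigma> * sqrt 2) / sqrt (2 ^ n * fact n)"
    by (simp flip: real_sqrt_divide)
  then show ?thesis
    by (simp add: gamma_star_def Let_def b hermite_normalized_def flip: w a)
qed

text \<open>
  Mehler's formula at \<open>(a x, a y)\<close>.  The choice of \<open>a\<close> makes the mixed term of its exponent
  \<open>x y / h\<^sup>2\<close>; its square terms come out as \<open>- w x\<^sup>2 / (2 h\<^sup>2)\<close> instead of \<open>- x\<^sup>2 / (2 h\<^sup>2)\<close>, and the
  damping factors supply the missing \<open>- (1 - w) x\<^sup>2 / (2 h\<^sup>2)\<close>, likewise in \<open>y\<close>.
\<close>
lemma gauss_kernel_expansion:
  assumes "h > 0" and w: "0 < w" "w < 1" and a: "a = a_coef h w"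
  shows "(\<lambda>n. w ^ n * (hermite_normalized n (a * x) * hermite_normalized n (a * y))
      * (exp (- ((1 - w) / h\<^sup>2 * x\<^sup>2 / 2)) * exp (- ((1 - w) / h\<^sup>2 * y\<^sup>2 / 2))))
    sums (sqrt (2 * pi) * h / sqrt (1 - w\<^sup>2) * gauss_kernel h x y)"
proof -
  have w2: "1 - w\<^sup>2 > 0" using w by (simp add: power_less_one_iff)
  then have a2: "a\<^sup>2 = (1 - w\<^sup>2) / (2 * h\<^sup>2 * w)"
    using assms by (simp add: a a_coef_def)
  have "(2 * (a * x) * (a * y) * w - w\<^sup>2 * ((a * x)\<^sup>2 + (a * y)\<^sup>2)) / (1 - w\<^sup>2)
      = a\<^sup>2 * (w * (2 * x * y - w * (x\<^sup>2 + y\<^sup>2)) / (1 - w\<^sup>2))"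
    by (simp add: power2_eq_square algebra_simps)
  also have "\<dots> = (2 * x * y - w * (x\<^sup>2 + y\<^sup>2)) / (2 * h\<^sup>2)"
    unfolding a2 using w2 w by simp
  also have "\<dots> + (- ((1 - w) / h\<^sup>2 * x\<^sup>2 / 2) + - ((1 - w) / h\<^sup>2 * y\<^sup>2 / 2)) = - ((x - y)\<^sup>2 / (2 * h\<^sup>2))"
    using assms(1) by (simp add: field_simps power2_eq_square)
  finally have expo: "exp ((2 * (a * x) * (a * y) * w - w\<^sup>2 * ((a * x)\<^sup>2 + (a * y)\<^sup>2)) / (1 - w\<^sup>2))
       * (exp (- ((1 - w) / h\<^sup>2 * x\<^sup>2 / 2)) * exp (- ((1 - w) / h\<^sup>2 * y\<^sup>2 / 2))) = exp (- ((x - y)\<^sup>2 / (2 * h\<^sup>2)))"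
    by (simp only: exp_add[symmetric])
  have "\<bar>w\<bar> < 1" using w by simp
  note mehler = sums_mult2[OF mehler_formula[OF this, of "a * x" "a * y"],
      of "exp (- ((1 - w) / h\<^sup>2 * x\<^sup>2 / 2)) * exp (- ((1 - w) / h\<^sup>2 * y\<^sup>2 / 2))"]
  have "exp (- ((x - y)\<^sup>2 / (2 * h\<^sup>2))) / sqrt (1 - w\<^sup>2)
      = sqrt (2 * pi) * h / sqrt (1 - w\<^sup>2) * gauss_kernel h x y"
    using assms(1) by (simp add: gauss_kernel_def)
  with mehler show ?thesis
    by (simp only: times_divide_eq_left[of "exp _" "sqrt _" "exp _ * exp _"] expo)
qed

theorem theorem3:
  fixes h \<sigma> :: real
  assumes "h > 0" and "\<sigma> > 0"
  shows "0 < w_star (h\<^sup>2 / \<sigma>\<^sup>2) \<and> w_star (h\<^sup>2 / \<sigma>\<^sup>2) < 1 \<and>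
    spectral_decomposition (normal_measure \<sigma>) (gauss_kernel h)
      (\<lambda>n. alpha_coef h \<sigma> * w_star (h\<^sup>2 / \<sigma>\<^sup>2) ^ n) (gamma_star h \<sigma>)"
proof -
  define w where "w = w_star (h\<^sup>2 / \<sigma>\<^sup>2)"
  define a where "a = a_coef h w"
  define e where "e x = exp (- ((1 - w) / h\<^sup>2 * x\<^sup>2 / 2))" for x
  have "h\<^sup>2 / \<sigma>\<^sup>2 > 0" using assms by simp
  from w_star_properties[OF this] have w: "0 < w" "w < 1" and quad: "(1 - w)\<^sup>2 = h\<^sup>2 / \<sigma>\<^sup>2 * w"
    by (simp_all add: w_def)
  have w2: "1 - w\<^sup>2 > 0" using w by (simp add: power_less_one_iff)
  then have a: "a > 0" and a2: "a\<^sup>2 = (1 - w\<^sup>2) / (2 * h\<^sup>2 * w)"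
    using assms w by (simp_all add: a_def a_coef_def)
  have \<gamma>: "gamma_star h \<sigma> n x = sqrt (a * \<sigma> * sqrt 2) * hermite_normalized n (a * x) * e x" for n x
    unfolding e_def by (rule gamma_star_eq[OF assms w_def a_def])
  have \<alpha>: "alpha_coef h \<sigma> = sqrt (1 - w\<^sup>2) / (2 * sqrt pi * h * a * \<sigma>)"
    by (simp add: alpha_coef_def Let_def a_def w_def)
  \<comment> \<open>the quadratic equation for \<open>w\<close> turns the exponents into the orthonormality condition\<close>
  have "1 / \<sigma>\<^sup>2 = (1 - w)\<^sup>2 / (h\<^sup>2 * w)"
    unfolding quad using assms w by simp
  then have \<sigma>2: "1 / (2 * \<sigma>\<^sup>2) = (1 - w)\<^sup>2 / (2 * h\<^sup>2 * w)" by simp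
  have c: "(1 - w) / h\<^sup>2 = a\<^sup>2 - 1 / (2 * \<sigma>\<^sup>2)"
    unfolding a2 \<sigma>2 using assms(1) w by (simp add: field_simps power2_eq_square)
  have prob: "prob_space (normal_measure \<sigma>)"
    unfolding normal_measure_def using assms by (intro prob_space_normal_density)
  have "spectral_decomposition (normal_measure \<sigma>) (gauss_kernel h)
      (\<lambda>n. alpha_coef h \<sigma> * w ^ n) (gamma_star h \<sigma>)"
  proof (rule spectral_decompositionI)
    show "L2_kernel (normal_measure \<sigma>) (gauss_kernel h)"
      using assms prob by (intro L2_kernel_gauss) (simp_all add: normal_measure_def)
    show "orthonormal_L2 (normal_measure \<sigma>) (gamma_star h \<sigma>)"
      using orthonormal_scaled_hermite[OF a assms(2) c] by (simp add: \<gamma>[abs_def] e_def)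
    fix x y
    have "\<bar>w\<bar> < 1" using w by simp
    note summable = summable_hermite_normalized[OF this]
    show "summable (\<lambda>n. \<bar>alpha_coef h \<sigma> * w ^ n * gamma_star h \<sigma> n x\<bar>)"
      using summable_mult[OF summable(1)[of "a * x"], of "\<bar>alpha_coef h \<sigma> * sqrt (a * \<sigma> * sqrt 2) * e x\<bar>"]
      by (simp add: \<gamma> abs_mult power_abs mult_ac)
    show "summable (\<lambda>n. \<bar>alpha_coef h \<sigma> * w ^ n * gamma_star h \<sigma> n x * gamma_star h \<sigma> n y\<bar>)"
      using summable_mult[OF summable(2)[of "a * x" "a * y"],
          of "\<bar>alpha_coef h \<sigma> * sqrt (a * \<sigma> * sqrt 2) * sqrt (a * \<sigma> * sqrt 2) * e x * e y\<bar>"]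
      by (simp add: \<gamma> abs_mult power_abs mult_ac del: real_sqrt_mult_self)
    have s: "sqrt (a * \<sigma> * sqrt 2) * sqrt (a * \<sigma> * sqrt 2) = a * \<sigma> * sqrt 2"
      using a assms by simp
    have const: "alpha_coef h \<sigma> * (a * \<sigma> * sqrt 2) * (sqrt (2 * pi) * h / sqrt (1 - w\<^sup>2)) = 1"
      unfolding \<alpha> using a assms w2 by (simp add: real_sqrt_mult)
    have "alpha_coef h \<sigma> * w ^ n * gamma_star h \<sigma> n x * gamma_star h \<sigma> n y
        = alpha_coef h \<sigma> * (sqrt (a * \<sigma> * sqrt 2) * sqrt (a * \<sigma> * sqrt 2))
          * (w ^ n * (hermite_normalized n (a * x) * hermite_normalized n (a * y)) * (e x * e y))" for n
      unfolding \<gamma> by (simp only: mult_ac)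
    note summand = this[unfolded s]
    have "(\<lambda>n. alpha_coef h \<sigma> * w ^ n * gamma_star h \<sigma> n x * gamma_star h \<sigma> n y)
        sums (alpha_coef h \<sigma> * (a * \<sigma> * sqrt 2) * (sqrt (2 * pi) * h / sqrt (1 - w\<^sup>2) * gauss_kernel h x y))"
      unfolding summand e_def by (intro sums_mult gauss_kernel_expansion assms w a_def)
    then show "(\<lambda>n. alpha_coef h \<sigma> * w ^ n * gamma_star h \<sigma> n x * gamma_star h \<sigma> n y)
        sums gauss_kernel h x y"
      using const by (simp only: mult.assoc[symmetric] mult_1_left)
  qed (rule prob)
  then show ?thesis using w by (simp add: w_def)
qed

end
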